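(* Let $K$ be a field, and let $I$ and $J$ be monomial ideals in $R = K[x_1,\ldots,x_n]$, each generated in a single degree (all minimal monomial generators of $I$ have the same degree $\delta_I$, and all minimal monomial generators of $J$ have the same degree $\delta_J$). Then $\widehat{IJ} = \widehat{I}\,\widehat{J}$.
   Context: For a monomial ideal $I \subseteq R = K[x_1,\ldots,x_n]$ with (unique) minimal set of monomial generators $\{f_1,\ldots,f_\nu\}$, put $m_I = \operatorname{lcm}(f_1,\ldots,f_\nu)$. The LCM-dual of $I$ is the monomial ideal $\widehat I$ generated by the monomials $\widehat{f_i} = m_I/f_i$, $i=1,\ldots,\nu$. *)

theory Defs
  imports "HOL-Library.Poly_Mapping" "HOL-Algebra.Ideal_Product" "HOL-Algebra.Algebraic_Closure_Type"
begin

text \<open>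
  For a finite type \<open>'n\<close> with \<open>n\<close> elements, \<open>('n, 'k) mpoly\<close> is \<open>K[x\<^sub>1, \<dots>, x\<^sub>n]\<close>: a polynomial maps
  an exponent vector to its coefficient, and multiplication is convolution.
\<close>

type_synonym ('n, 'k) mpoly = "('n \<Rightarrow>\<^sub>0 nat) \<Rightarrow>\<^sub>0 'k"

abbreviation poly_ring :: "('n, 'k::field) mpoly ring" (\<open>\<R>\<close>)
  where "\<R> \<equiv> ring_of_type_algebra"

text \<open>Monomials have coefficient 1 and are represented by their exponent vectors.\<close>

definition xpow :: "('n \<Rightarrow>\<^sub>0 nat) \<Rightarrow> ('n, 'k::field) mpoly"
  where "xpow a = Poly_Mapping.single a 1"

definition monom_degree :: "('n::finite \<Rightarrow>\<^sub>0 nat) \<Rightarrow> nat"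
  where "monom_degree a = (\<Sum>i\<in>UNIV. Poly_Mapping.lookup a i)"

definition gen_ideal :: "('n \<Rightarrow>\<^sub>0 nat) set \<Rightarrow> ('n, 'k::field) mpoly set"
  where "gen_ideal A = Idl\<^bsub>\<R>\<^esub> (xpow ` A)"

definition monomial_ideal :: "('n, 'k::field) mpoly set \<Rightarrow> bool"
  where "monomial_ideal I \<longleftrightarrow> (\<exists>A. I = gen_ideal A)"

definition is_min_gens :: "('n \<Rightarrow>\<^sub>0 nat) set \<Rightarrow> ('n, 'k::field) mpoly set \<Rightarrow> bool"
  where "is_min_gens A I \<longleftrightarrow> gen_ideal A = I \<and> (\<forall>B. B \<subset> A \<longrightarrow> gen_ideal B \<noteq> I)"

definition min_gens :: "('n, 'k::field) mpoly set \<Rightarrow> ('n \<Rightarrow>\<^sub>0 nat) set"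
  where "min_gens I = (THE A. is_min_gens A I)"

text \<open>
  The exponent vector of the least common multiple of a finite set of monomials; inserting 0
  only matters for the empty set, whose least common multiple is 1. (The minimal generating set
  of a monomial ideal is always finite, by Dickson's lemma.)
\<close>

definition lcm_exp :: "('n::finite \<Rightarrow>\<^sub>0 nat) set \<Rightarrow> ('n \<Rightarrow>\<^sub>0 nat)"
  where "lcm_exp A = Abs_poly_mapping (\<lambda>i. Max (insert 0 ((\<lambda>a. Poly_Mapping.lookup a i) ` A)))"

definition lcm_dual :: "('n::finite, 'k::field) mpoly set \<Rightarrow> ('n, 'k) mpoly set"
  where "lcm_dual I = gen_ideal ((\<lambda>a. lcm_exp (min_gens I) - a) ` min_gens I)"

text \<open>
  The following facts show that these notions are the intended ones: the minimal generating set
  exists and is unique, \<open>lcm_exp\<close> satisfies the universal property of the least common multiple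
  in the polynomial ring, and subtracting exponent vectors is exact division.
\<close>

lemma xpow_mult: "xpow (a + b) = xpow a * xpow b"
  by (simp add: xpow_def mult_single)

definition exp_le :: "('n \<Rightarrow>\<^sub>0 nat) \<Rightarrow> ('n \<Rightarrow>\<^sub>0 nat) \<Rightarrow> bool"
  where "exp_le a b \<longleftrightarrow> (\<forall>i. Poly_Mapping.lookup a i \<le> Poly_Mapping.lookup b i)"

lemma exp_le_add: "exp_le a b \<Longrightarrow> a + (b - a) = b"
  by (rule poly_mapping_eqI) (simp add: exp_le_def lookup_add lookup_minus)

lemma exp_le_trans: "exp_le a b \<Longrightarrow> exp_le b c \<Longrightarrow> exp_le a c"
  by (meson exp_le_def order_trans)

lemma exp_le_antisym: "exp_le a b \<Longrightarrow> exp_le b a \<Longrightarrow> a = b"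
  by (rule poly_mapping_eqI) (simp add: exp_le_def order_antisym)

lemma mpoly_eq_sum_single: "f = (\<Sum>k\<in>Poly_Mapping.keys f. Poly_Mapping.single k (Poly_Mapping.lookup f k))"
  by (rule poly_mapping_eqI)
     (auto simp: lookup_sum lookup_single in_keys_iff when_def)

lemma mem_gen_ideal:
  "f \<in> gen_ideal A \<longleftrightarrow> (\<forall>k\<in>Poly_Mapping.keys f. \<exists>a\<in>A. exp_le a k)"
proof -
  define S where "S = {f :: ('a,'b) mpoly. \<forall>k\<in>Poly_Mapping.keys f. \<exists>a\<in>A. exp_le a k}"
  interpret R: cring "\<R> :: ('a,'b) mpoly ring" by (rule cring_from_type_algebra)
  have idl: "ideal (gen_ideal A :: ('a,'b) mpoly set) \<R>"
    unfolding gen_ideal_def by (rule R.genideal_ideal) (simp add: ring_of_type_algebra_def)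
  have S: "ideal S \<R>"
  proof (rule idealI)
    show "ring (\<R> :: ('a,'b) mpoly ring)" by (rule R.ring_axioms)
    show "subgroup S (add_monoid \<R>)"
    proof (rule group.subgroupI)
      show "group (add_monoid (\<R> :: ('a,'b) mpoly ring))" by (rule R.a_group)
      show "S \<subseteq> carrier (add_monoid \<R>)" by (simp add: ring_of_type_algebra_def)
      show "S \<noteq> {}" by (auto simp: S_def intro: exI[of _ 0])
      fix f g assume f: "f \<in> S" and g: "g \<in> S"
      show "f \<otimes>\<^bsub>add_monoid \<R>\<^esub> g \<in> S"
        using f g keys_add[of f g] by (auto simp: S_def ring_of_type_algebra_def)
      have "f \<otimes>\<^bsub>add_monoid \<R>\<^esub> (-f) = \<one>\<^bsub>add_monoid \<R>\<^esub>" by (simp add: ring_of_type_algebra_def)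
      then have "inv\<^bsub>add_monoid \<R>\<^esub> f = - f"
        by (intro comm_monoid.comm_inv_char) 
           (use R.a_comm_group comm_group_def in \<open>auto simp: ring_of_type_algebra_def\<close>)
      then show "inv\<^bsub>add_monoid \<R>\<^esub> f \<in> S" using f
        by (auto simp: S_def in_keys_iff)
    qed
    have m: "h * f \<in> S" if "f \<in> S" for f h
    proof -
      have "\<exists>a\<in>A. exp_le a k" if k: "k \<in> Poly_Mapping.keys (h * f)" for k
      proof -
        from k keys_mult[of h f] obtain p q where "k = p + q" "q \<in> Poly_Mapping.keys f" by blast
        with \<open>f \<in> S\<close> show ?thesis unfolding S_def exp_le_def
          by (fastforce simp: lookup_add intro: trans_le_add2)
      qed
      then show ?thesis by (simp add: S_def)
    qed
    show "h \<otimes>\<^bsub>\<R>\<^esub> f \<in> S" "f \<otimes>\<^bsub>\<R>\<^esub> h \<in> S" if "f \<in> S" for f h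
      using m[OF that, of h] by (simp_all add: ring_of_type_algebra_def mult.commute)
  qed
  have "xpow ` A \<subseteq> S"
    by (auto simp: S_def xpow_def exp_le_def)
  then have 1: "gen_ideal A \<subseteq> S"
    unfolding gen_ideal_def using S by (rule R.genideal_minimal[rotated])
  have single: "Poly_Mapping.single k c \<in> gen_ideal A" if "a \<in> A" "exp_le a k" for a k and c :: 'b
  proof -
    have "(xpow a :: ('a,'b) mpoly) \<in> gen_ideal A"
      unfolding gen_ideal_def
      using R.genideal_self[of "xpow ` A"] that by (auto simp: ring_of_type_algebra_def)
    then have "Poly_Mapping.single (k - a) c \<otimes>\<^bsub>\<R>\<^esub> xpow a \<in> gen_ideal A"
      by (rule ideal.I_l_closed[OF idl]) (simp add: ring_of_type_algebra_def)
    moreover have "Poly_Mapping.single (k - a) c * xpow a = Poly_Mapping.single k c"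
      using exp_le_add[OF that(2)] by (simp add: xpow_def mult_single add.commute)
    ultimately show ?thesis by (simp add: ring_of_type_algebra_def)
  qed
  have add: "f + g \<in> gen_ideal A" if "f \<in> gen_ideal A" "g \<in> gen_ideal A" for f g :: "('a,'b) mpoly"
    using additive_subgroup.a_closed[OF ideal.axioms(1)[OF idl] that]
    by (simp add: ring_of_type_algebra_def)
  have zero: "(0 :: ('a,'b) mpoly) \<in> gen_ideal A"
    using additive_subgroup.zero_closed[OF ideal.axioms(1)[OF idl]]
    by (simp add: ring_of_type_algebra_def)
  have 2: "f \<in> gen_ideal A" if "f \<in> S" for f
  proof -
    have "sum (\<lambda>k. Poly_Mapping.single k (Poly_Mapping.lookup f k)) K \<in> gen_ideal A"
      if "finite K" "K \<subseteq> Poly_Mapping.keys f" for K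
      using that
    proof (induction K)
      case (insert x K)
      then obtain a where "a \<in> A" "exp_le a x" using \<open>f \<in> S\<close> by (auto simp: S_def)
      with insert show ?case by (auto intro!: add single)
    qed (simp add: zero)
    from this[of "Poly_Mapping.keys f"] show ?thesis using mpoly_eq_sum_single[of f] by simp
  qed
  from 1 2 show ?thesis by (auto simp: S_def)
qed


lemma xpow_dvd_iff:
  "xpow a dvd f \<longleftrightarrow> (\<forall>k\<in>Poly_Mapping.keys f. exp_le a k)"
proof
  assume "xpow a dvd f"
  then obtain g where g: "f = xpow a * g" by (elim dvdE)
  show "\<forall>k\<in>Poly_Mapping.keys f. exp_le a k"
  proof
    fix k assume "k \<in> Poly_Mapping.keys f"
    with g keys_mult[of "xpow a" g] obtain q where "k = a + q"
      by (fastforce simp: xpow_def split: if_splits)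
    then show "exp_le a k" by (simp add: exp_le_def lookup_add)
  qed
next
  assume *: "\<forall>k\<in>Poly_Mapping.keys f. exp_le a k"
  have "xpow a dvd Poly_Mapping.single k (Poly_Mapping.lookup f k)"
    if "k \<in> Poly_Mapping.keys f" for k
  proof (rule dvdI)
    show "Poly_Mapping.single k (Poly_Mapping.lookup f k)
      = xpow a * Poly_Mapping.single (k - a) (Poly_Mapping.lookup f k)"
      using * that by (simp add: xpow_def mult_single exp_le_add)
  qed
  then show "xpow a dvd f"
    by (subst mpoly_eq_sum_single) (rule dvd_sum)
qed

lemma lookup_lcm_exp:
  "Poly_Mapping.lookup (lcm_exp A) i = Max (insert 0 ((\<lambda>a. Poly_Mapping.lookup a i) ` A))"
  by (simp add: lcm_exp_def)

lemma xpow_lcm_exp_dvd_iff: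
  assumes "finite A"
  shows "xpow (lcm_exp A) dvd f \<longleftrightarrow> (\<forall>a\<in>A. xpow a dvd f)"
  using assms by (auto simp: xpow_dvd_iff exp_le_def lookup_lcm_exp)

lemma xpow_lcm_exp_diff:
  assumes "finite A" "a \<in> A"
  shows "xpow (lcm_exp A - a) * xpow a = xpow (lcm_exp A)"
proof -
  have "exp_le a (lcm_exp A)"
    using assms by (simp add: exp_le_def lookup_lcm_exp)
  from exp_le_add[OF this] show ?thesis
    by (simp add: add.commute flip: xpow_mult)
qed

lemma gen_ideal_subset_iff:
  "(gen_ideal A :: ('n, 'k::field) mpoly set) \<subseteq> gen_ideal B \<longleftrightarrow> (\<forall>a\<in>A. \<exists>b\<in>B. exp_le b a)"
proof
  assume *: "(gen_ideal A :: ('n, 'k) mpoly set) \<subseteq> gen_ideal B"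
  show "\<forall>a\<in>A. \<exists>b\<in>B. exp_le b a"
  proof
    fix a assume "a \<in> A"
    then have "(xpow a :: ('n, 'k) mpoly) \<in> gen_ideal A"
      by (auto simp: mem_gen_ideal xpow_def exp_le_def)
    with * have "(xpow a :: ('n, 'k) mpoly) \<in> gen_ideal B" by blast
    then show "\<exists>b\<in>B. exp_le b a" by (simp add: mem_gen_ideal xpow_def)
  qed
next
  assume "\<forall>a\<in>A. \<exists>b\<in>B. exp_le b a"
  then show "(gen_ideal A :: ('n, 'k) mpoly set) \<subseteq> gen_ideal B"
    by (auto simp: mem_gen_ideal) (meson exp_le_trans)
qed

lemma is_min_gens_unique:
  fixes I :: "('n, 'k::field) mpoly set"
  assumes "is_min_gens A I" "is_min_gens B I"
  shows "A = B"
proof -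
  have "A \<subseteq> B" if A: "is_min_gens A I" and B: "is_min_gens B I" for A B
  proof
    fix a assume a: "a \<in> A"
    have eq: "gen_ideal A = I" "gen_ideal B = I" using A B by (auto simp: is_min_gens_def)
    with a obtain b where b: "b \<in> B" "exp_le b a"
      using gen_ideal_subset_iff[of A B, where 'k = 'k] by auto
    with eq obtain a' where a': "a' \<in> A" "exp_le a' b"
      using gen_ideal_subset_iff[of B A, where 'k = 'k] by auto
    have "a' = a"
    proof (rule ccontr)
      assume "a' \<noteq> a"
      have "exp_le c c" for c :: "'n \<Rightarrow>\<^sub>0 nat" by (simp add: exp_le_def)
      then have "\<forall>c\<in>A. \<exists>d\<in>A - {a}. exp_le d c"
        using \<open>a' \<noteq> a\<close> a' b exp_le_trans by (metis Diff_iff empty_iff insert_iff)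
      then have "(gen_ideal A :: ('n, 'k) mpoly set) \<subseteq> gen_ideal (A - {a})"
        by (simp add: gen_ideal_subset_iff)
      moreover have "(gen_ideal (A - {a}) :: ('n, 'k) mpoly set) \<subseteq> gen_ideal A"
        by (auto simp: gen_ideal_subset_iff exp_le_def)
      ultimately show False using A a eq by (auto simp: is_min_gens_def)
    qed
    with a' b have "b = a" by (auto dest: exp_le_antisym)
    with b show "a \<in> B" by simp
  qed
  with assms show ?thesis by blast
qed

lemma is_min_gens_exists:
  fixes I :: "('n::finite, 'k::field) mpoly set"
  assumes "monomial_ideal I"
  shows "\<exists>A. is_min_gens A I"
proof -
  from assms obtain A where A: "I = gen_ideal A" by (auto simp: monomial_ideal_def)
  define M where "M = {a\<in>A. \<forall>b\<in>A. exp_le b a \<longrightarrow> b = a}"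
  have deg: "monom_degree b < monom_degree a" if "exp_le b a" "b \<noteq> a" for a b :: "'n \<Rightarrow>\<^sub>0 nat"
  proof -
    from that obtain i where "Poly_Mapping.lookup b i < Poly_Mapping.lookup a i"
      unfolding exp_le_def poly_mapping_eq_iff fun_eq_iff using le_neq_implies_less by blast
    then show ?thesis using that(1) unfolding monom_degree_def exp_le_def
      by (intro sum_strict_mono_ex1) auto
  qed
  have "\<exists>m\<in>M. exp_le m a" if "a \<in> A" for a
    using that
  proof (induction "monom_degree a" arbitrary: a rule: less_induct)
    case less
    show ?case
    proof (cases "a \<in> M")
      case False
      with less.prems obtain b where "b \<in> A" "exp_le b a" "b \<noteq> a" by (auto simp: M_def)
      with less.hyps[OF deg] show ?thesis by (meson exp_le_trans)
    qed (auto simp: exp_le_def)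
  qed
  then have "(gen_ideal A :: ('n, 'k) mpoly set) \<subseteq> gen_ideal M"
    by (simp add: gen_ideal_subset_iff)
  moreover have "(gen_ideal M :: ('n, 'k) mpoly set) \<subseteq> gen_ideal A"
    by (auto simp: gen_ideal_subset_iff M_def exp_le_def)
  ultimately have M: "gen_ideal M = I" using A by simp
  have "gen_ideal B \<noteq> I" if "B \<subset> M" for B
  proof
    assume "gen_ideal B = I"
    with M have *: "(gen_ideal M :: ('n, 'k) mpoly set) \<subseteq> gen_ideal B" by simp
    from \<open>B \<subset> M\<close> obtain m where m: "m \<in> M" "m \<notin> B" by blast
    with * obtain b where "b \<in> B" "exp_le b m" by (auto simp: gen_ideal_subset_iff)
    with m \<open>B \<subset> M\<close> show False by (auto simp: M_def)
  qed
  with M show ?thesis by (auto simp: is_min_gens_def)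
qed

lemma is_min_gens_min_gens:
  fixes I :: "('n::finite, 'k::field) mpoly set"
  assumes "monomial_ideal I"
  shows "is_min_gens (min_gens I) I"
proof -
  from is_min_gens_exists[OF assms] obtain A where "is_min_gens A I" ..
  then show ?thesis
    unfolding min_gens_def by (rule theI) (rule is_min_gens_unique[OF _ \<open>is_min_gens A I\<close>])
qed

end

theory Submission
  imports Defs "HOL-Library.Set_Algebras"
begin

text \<open>
  Let \<open>A\<close> and \<open>B\<close> be the sets of exponent vectors of the minimal generators of \<open>I\<close> and \<open>J\<close>. The
  product \<open>I J\<close> is always generated by the Minkowski sum \<open>A + B\<close> (\<open>gen_ideal_mult\<close>), but in general
  some of these generators are redundant, and the dual of \<open>I J\<close> may then lack some of the products
  of generators of the duals. This is where the hypothesis on degrees enters: all elements of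
  \<open>A + B\<close> have degree \<open>\<delta>\<^sub>I + \<delta>\<^sub>J\<close>, and monomials of equal degree divide each other only
  if they are equal, so that \<open>A + B\<close> is the minimal generating set
  (\<open>min_gens_gen_ideal_same_degree\<close>).

  The rest is valid for arbitrary finite sets of monomials. The exponent of a variable in
  a least common multiple is a maximum, and the maximum of sums \<open>a\<^sub>i + b\<^sub>i\<close> with
  independent summands is the sum of the maxima; hence \<open>lcm (A + B) = lcm A + lcm B\<close>. The generators
  of the dual of \<open>I J\<close> therefore have the exponents
  \<open>(lcm A + lcm B) - (a + b) = (lcm A - a) + (lcm B - b)\<close>, which are the exponents of the products of
  generators of the two duals (\<open>complement_set_plus\<close>).
\<close>

lemma monom_degree_add: "monom_degree (a + b) = monom_degree a + monom_degree b"
  by (simp add: monom_degree_def lookup_add sum.distrib)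

lemma exp_le_same_degree_imp_eq:
  assumes "exp_le a b" "monom_degree a = monom_degree b"
  shows "a = b"
proof -
  have b: "a + (b - a) = b" using assms(1) by (rule exp_le_add)
  then have "monom_degree (b - a) = 0"
    using monom_degree_add[of a "b - a"] assms(2) by simp
  then have "b - a = 0"
    by (intro poly_mapping_eqI) (simp add: monom_degree_def)
  with b show ?thesis by simp
qed

text \<open>
  The exponents of a monomial are bounded by its degree, which makes the generating sets at hand
  finite without an appeal to Dickson's lemma.
\<close>

lemma finite_same_degree:
  fixes A :: "('n::finite \<Rightarrow>\<^sub>0 nat) set"
  assumes "\<forall>a\<in>A. monom_degree a = d"
  shows "finite A"
proof (rule inj_on_finite)
  show "inj_on Poly_Mapping.lookup A" by (auto intro!: inj_onI poly_mapping_eqI)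
  have "Poly_Mapping.lookup a i \<le> d" if "a \<in> A" for a i
    using member_le_sum[of i UNIV "Poly_Mapping.lookup a"] assms that
    by (auto simp: monom_degree_def)
  then show "Poly_Mapping.lookup ` A \<subseteq> (\<Pi>\<^sub>E i\<in>UNIV. {..d})" by auto
  show "finite ((\<Pi>\<^sub>E i\<in>UNIV. {..d}) :: ('n \<Rightarrow> nat) set)" by (intro finite_PiE) auto
qed

lemma min_gens_gen_ideal_same_degree:
  assumes deg: "\<forall>a\<in>A. monom_degree a = d"
  shows "min_gens (gen_ideal A :: ('n::finite, 'k::field) mpoly set) = A"
proof -
  have "is_min_gens A (gen_ideal A :: ('n, 'k) mpoly set)"
    unfolding is_min_gens_def
  proof (intro conjI allI impI notI)
    fix B assume B: "B \<subset> A" and "gen_ideal B = (gen_ideal A :: ('n, 'k) mpoly set)"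
    then have divisor: "\<forall>a\<in>A. \<exists>b\<in>B. exp_le b a"
      using gen_ideal_subset_iff[of A B, where 'k = 'k] by simp
    have "A \<subseteq> B"
    proof
      fix a assume "a \<in> A"
      with divisor obtain b where "b \<in> B" "exp_le b a" by blast
      moreover have "b = a"
        using \<open>exp_le b a\<close> \<open>b \<in> B\<close> \<open>a \<in> A\<close> B deg by (intro exp_le_same_degree_imp_eq) auto
      ultimately show "a \<in> B" by simp
    qed
    with B show False by auto
  qed simp
  then show ?thesis
    unfolding min_gens_def by (metis is_min_gens_unique the_equality)
qed

text \<open>
  Membership in a monomial ideal can be tested on the terms of a polynomial, and every term of
  \<open>f * g\<close> has the product of a monomial of \<open>f\<close> and one of \<open>g\<close>; this gives the inclusion from left
  to right.
\<close>

lemma gen_ideal_mult: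
  "gen_ideal A \<cdot>\<^bsub>\<R>\<^esub> gen_ideal B = (gen_ideal (A + B) :: ('n, 'k::field) mpoly set)"
proof
  show "gen_ideal A \<cdot>\<^bsub>\<R>\<^esub> gen_ideal B \<subseteq> (gen_ideal (A + B) :: ('n, 'k) mpoly set)"
  proof
    fix h :: "('n, 'k) mpoly"
    assume "h \<in> gen_ideal A \<cdot>\<^bsub>\<R>\<^esub> gen_ideal B"
    then show "h \<in> gen_ideal (A + B)"
    proof (induction rule: ideal_prod.induct)
      case (prod f g)
      have "\<exists>c\<in>A + B. exp_le c k" if "k \<in> Poly_Mapping.keys (f * g)" for k
      proof -
        from that keys_mult[of f g] obtain p q
          where k: "k = p + q" "p \<in> Poly_Mapping.keys f" "q \<in> Poly_Mapping.keys g"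
          by blast
        with prod obtain a b where "a \<in> A" "exp_le a p" "b \<in> B" "exp_le b q"
          by (meson mem_gen_ideal)
        with k show ?thesis
          by (intro bexI[of _ "a + b"]) (auto simp: exp_le_def lookup_add add_mono)
      qed
      then show ?case by (simp add: mem_gen_ideal ring_of_type_algebra_def)
    next
      case (sum f g)
      then show ?case
        using keys_add[of f g] by (auto simp: mem_gen_ideal ring_of_type_algebra_def)
    qed
  qed
next
  interpret cring "\<R> :: ('n, 'k) mpoly ring" by (rule cring_from_type_algebra)
  have gen: "ideal (gen_ideal S :: ('n, 'k) mpoly set) \<R>" for S
    unfolding gen_ideal_def by (rule genideal_ideal) (simp add: ring_of_type_algebra_def)
  have "xpow (a + b) \<in> gen_ideal A \<cdot>\<^bsub>\<R>\<^esub> (gen_ideal B :: ('n, 'k) mpoly set)"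
    if "a \<in> A" "b \<in> B" for a b
  proof -
    have "xpow a \<in> (gen_ideal A :: ('n, 'k) mpoly set)" "xpow b \<in> (gen_ideal B :: ('n, 'k) mpoly set)"
      using that by (auto simp: mem_gen_ideal xpow_def exp_le_def)
    from ideal_prod.prod[OF this, of \<R>] show ?thesis
      by (simp add: ring_of_type_algebra_def xpow_mult)
  qed
  then show "(gen_ideal (A + B) :: ('n, 'k) mpoly set) \<subseteq> gen_ideal A \<cdot>\<^bsub>\<R>\<^esub> gen_ideal B"
    unfolding gen_ideal_def[of "A + B"]
    by (intro genideal_minimal ideal_prod_is_ideal gen) (auto elim: set_plus_elim)
qed

lemma exp_le_lcm_exp: "finite A \<Longrightarrow> a \<in> A \<Longrightarrow> exp_le a (lcm_exp A)"
  by (simp add: exp_le_def lookup_lcm_exp)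

lemma lookup_lcm_exp_attained:
  assumes "finite A" "A \<noteq> {}"
  obtains a where "a \<in> A" "Poly_Mapping.lookup a i = Poly_Mapping.lookup (lcm_exp A) i"
proof -
  have "Poly_Mapping.lookup (lcm_exp A) i = Max ((\<lambda>a. Poly_Mapping.lookup a i) ` A)"
    using assms by (simp add: lookup_lcm_exp)
  also have "\<dots> \<in> (\<lambda>a. Poly_Mapping.lookup a i) ` A"
    using assms by (intro Max_in) auto
  finally show ?thesis using that by auto
qed

text \<open>
  Each coordinate of the two least common multiples is attained by some \<open>a\<close> and some \<open>b\<close>, and these
  can be combined because \<open>A + B\<close> contains every sum. If one of the sets is empty, then so is
  \<open>A + B\<close>; its least common multiple is 1, whatever that of the other set is.
\<close>

lemma lcm_exp_set_plus:
  assumes "finite A" "A \<noteq> {}" "finite B" "B \<noteq> {}"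
  shows "lcm_exp (A + B) = lcm_exp A + lcm_exp B"
proof (rule poly_mapping_eqI)
  fix i
  have fin: "finite (A + B)" using assms by (intro finite_set_plus)
  obtain a where a: "a \<in> A" "Poly_Mapping.lookup a i = Poly_Mapping.lookup (lcm_exp A) i"
    using lookup_lcm_exp_attained[OF assms(1,2)] .
  obtain b where b: "b \<in> B" "Poly_Mapping.lookup b i = Poly_Mapping.lookup (lcm_exp B) i"
    using lookup_lcm_exp_attained[OF assms(3,4)] .
  have "Poly_Mapping.lookup (a + b) i \<le> Poly_Mapping.lookup (lcm_exp (A + B)) i"
    using exp_le_lcm_exp[OF fin, of "a + b"] a b by (auto simp: exp_le_def)
  moreover have "A + B \<noteq> {}" using a b by blast
  then obtain c where c: "c \<in> A + B"
      "Poly_Mapping.lookup c i = Poly_Mapping.lookup (lcm_exp (A + B)) i"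
    using lookup_lcm_exp_attained[OF fin] by blast
  then obtain a' b' where "c = a' + b'" "a' \<in> A" "b' \<in> B" by (auto elim: set_plus_elim)
  then have "Poly_Mapping.lookup c i \<le> Poly_Mapping.lookup (lcm_exp A + lcm_exp B) i"
    using exp_le_lcm_exp assms(1,3) by (auto simp: exp_le_def lookup_add intro!: add_mono)
  ultimately show
    "Poly_Mapping.lookup (lcm_exp (A + B)) i = Poly_Mapping.lookup (lcm_exp A + lcm_exp B) i"
    using a b c by (simp add: lookup_add)
qed

lemma exp_add_diff_add:
  assumes "exp_le a l" "exp_le b m"
  shows "(l + m) - (a + b) = (l - a) + (m - b)"
  using assms by (intro poly_mapping_eqI) (simp add: exp_le_def lookup_add lookup_minus)

lemma complement_set_plus:
  assumes "finite A" "finite B"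
  shows "(\<lambda>c. lcm_exp (A + B) - c) ` (A + B)
       = (\<lambda>a. lcm_exp A - a) ` A + (\<lambda>b. lcm_exp B - b) ` B"
proof (cases "A = {} \<or> B = {}")
  case True
  then show ?thesis by (auto simp: set_plus_def)
next
  case False
  have diff: "lcm_exp (A + B) - (a + b) = (lcm_exp A - a) + (lcm_exp B - b)"
    if "a \<in> A" "b \<in> B" for a b
    using that assms False by (simp add: lcm_exp_set_plus exp_add_diff_add exp_le_lcm_exp)
  show ?thesis
  proof (intro equalityI subsetI)
    fix x assume "x \<in> (\<lambda>c. lcm_exp (A + B) - c) ` (A + B)"
    then obtain a b where "a \<in> A" "b \<in> B" "x = lcm_exp (A + B) - (a + b)"
      by (auto elim!: set_plus_elim)
    then show "x \<in> (\<lambda>a. lcm_exp A - a) ` A + (\<lambda>b. lcm_exp B - b) ` B"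
      by (simp add: diff set_plus_intro)
  next
    fix x assume "x \<in> (\<lambda>a. lcm_exp A - a) ` A + (\<lambda>b. lcm_exp B - b) ` B"
    then obtain a b where "a \<in> A" "b \<in> B" "x = (lcm_exp A - a) + (lcm_exp B - b)"
      by (auto elim!: set_plus_elim)
    then show "x \<in> (\<lambda>c. lcm_exp (A + B) - c) ` (A + B)"
      by (auto simp flip: diff)
  qed
qed

theorem proposition2p4:
  fixes I J :: "('n::finite, 'k::field) mpoly set"
    and \<delta>\<^sub>I \<delta>\<^sub>J :: nat
  assumes "monomial_ideal I"
    and "monomial_ideal J"
    and "\<forall>a\<in>min_gens I. monom_degree a = \<delta>\<^sub>I"
    and "\<forall>b\<in>min_gens J. monom_degree b = \<delta>\<^sub>J"
  shows "lcm_dual (I \<cdot>\<^bsub>\<R>\<^esub> J) = lcm_dual I \<cdot>\<^bsub>\<R>\<^esub> lcm_dual J"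
proof -
  define A where "A = min_gens I"
  define B where "B = min_gens J"
  have "I = gen_ideal A" "J = gen_ideal B"
    using is_min_gens_min_gens assms(1,2) by (auto simp: A_def B_def is_min_gens_def)
  then have "I \<cdot>\<^bsub>\<R>\<^esub> J = gen_ideal (A + B)"
    by (simp add: gen_ideal_mult)
  moreover have "\<forall>c\<in>A + B. monom_degree c = \<delta>\<^sub>I + \<delta>\<^sub>J"
    using assms(3,4) by (auto simp: A_def B_def monom_degree_add elim!: set_plus_elim)
  ultimately have "min_gens (I \<cdot>\<^bsub>\<R>\<^esub> J) = A + B"
    by (metis min_gens_gen_ideal_same_degree)
  moreover have "finite A" "finite B"
    using finite_same_degree assms(3,4) by (auto simp: A_def B_def)
  ultimately show ?thesis
    by (simp add: lcm_dual_def complement_set_plus gen_ideal_mult flip: A_def B_def)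
qed

end
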